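(* For each $N\ge 1$ let $\sigma_N$ be the probability that a cell stabilizes in the random Boolean cellular automaton of size $N$ in which every cell has the rule $\varphi_6(x,y)=x+y \pmod 2$ with probability $1$. Then $$\liminf_{N\to\infty}\sigma_N=0,\qquad \limsup_{N\to\infty}\sigma_N=1.$$
   Context: The automaton of size $N$ lives on a circle of $N$ cells: states $X_i(t)\in\{0,1\}$ are indexed by $i\in\mathbb{Z}$ with the periodic convention $X_{i+kN}(t)=X_i(t)$ for all integers $k$. The initial states $X_i(0)$ of the $N$ cells are i.i.d. Bernoulli$(1/2)$. Here all cells use the rule $\varphi_6$, so that for $t=0,1,2,\dots$ $$X_i(t+1)=X_{i-1}(t)+X_{i+1}(t) \pmod 2 .$$ Only the initial state is random; $\mathbb{P}_N$ denotes the resulting probability measure. Cell $i$ stabilizes if there is a $T$ such that $X_i(t)=X_i(T)$ for all $t\ge T$. By stationarity the probability of this does not depend on $i$; $\sigma_N=\mathbb{P}_N(\text{cell }0\text{ stabilizes})$. *)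

theory Defs
  imports "HOL-Probability.Probability"
begin

definition phi6 :: "nat \<Rightarrow> nat \<Rightarrow> nat" where
  "phi6 x y = (x + y) mod 2"

text \<open>The initial values on the cells \<open>0, \<dots>, N - 1\<close> are extended periodically, so that
  \<open>cell_state phi N x t i\<close> makes sense for every integer index \<open>i\<close> and is \<open>N\<close>-periodic in \<open>i\<close>.\<close>

fun cell_state :: "(nat \<Rightarrow> nat \<Rightarrow> nat) \<Rightarrow> nat \<Rightarrow> (int \<Rightarrow> nat) \<Rightarrow> nat \<Rightarrow> int \<Rightarrow> nat" where
  "cell_state phi N x 0 i = x (i mod int N)"
| "cell_state phi N x (Suc t) i = phi (cell_state phi N x t (i - 1)) (cell_state phi N x t (i + 1))"

definition stabilizes :: "(nat \<Rightarrow> nat \<Rightarrow> nat) \<Rightarrow> nat \<Rightarrow> (int \<Rightarrow> nat) \<Rightarrow> int \<Rightarrow> bool" where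
  "stabilizes phi N x i \<longleftrightarrow> (\<exists>T. \<forall>t\<ge>T. cell_state phi N x t i = cell_state phi N x T i)"

definition initial_pmf :: "nat \<Rightarrow> (int \<Rightarrow> nat) pmf" where
  "initial_pmf N = Pi_pmf {0..<int N} 0 (\<lambda>_. map_pmf of_bool (bernoulli_pmf (1/2)))"

definition stab_prob :: "nat \<Rightarrow> real" where
  "stab_prob N = measure_pmf.prob (initial_pmf N) {x. stabilizes phi6 N x 0}"

end

theory Submission
  imports Defs
begin

text \<open>
  Over the field with two elements, encode a configuration as a polynomial in \<open>z\<close> modulo
  \<open>z\<^sup>N - 1\<close>, cell \<open>i\<close> being the coefficient of \<open>z\<^sup>i\<close>; one step of the automaton
  multiplies it by \<open>z + 1/z\<close>. In characteristic 2 the Frobenius identity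
  \<open>(z + 1/z)\<^bsup>2^k\<^esup> = z\<^bsup>2^k\<^esup> + z\<^bsup>-2^k\<^esup>\<close> holds, so \<open>2 ^ k\<close> steps at once amount to adding the two cells
  at distance \<open>2 ^ k\<close> (\<open>cell_state_phi6_add_power2\<close>). Two choices of \<open>N\<close> exploit this.

  If \<open>N = 2 ^ k\<close>, the two cells at distance \<open>2 ^ k\<close> coincide, so after \<open>2 ^ k\<close> steps
  every cell is \<open>0\<close> forever, and \<open>stab_prob N = 1\<close>.

  If \<open>N = 2 ^ k - 1\<close>, the two cells at distance \<open>2 ^ k\<close> are the two neighbours, so \<open>2 ^ k\<close> steps have
  the same effect as one. The evolution is thus periodic from time \<open>1\<close> on, and cell \<open>0\<close>
  stabilizes only if it is constant from time \<open>1\<close> on. In particular its values at the times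
  \<open>1, 2, 4, \<dots>, 2 ^ (k - 2)\<close> agree. These values are sums of two initial values over pairwise
  disjoint pairs of cells, so that flipping the initial value of cell \<open>2 ^ l\<close> changes just the one at
  time \<open>2 ^ l\<close>. Hence the sets obtained from the stabilizing configurations
  by these single flips are pairwise disjoint and equally large, which forces the stabilizing ones
  to have probability at most \<open>1 / (k - 1)\<close> when \<open>k \<ge> 4\<close>.
\<close>

section \<open>Evolution over a power of two many steps\<close>

lemma cell_state_phi6_add_power2:
  "cell_state phi6 N x (t + 2 ^ k) i =
     (cell_state phi6 N x t (i - 2 ^ k) + cell_state phi6 N x t (i + 2 ^ k)) mod 2"
proof (induction k arbitrary: t i)
  case 0
  show ?case by (simp add: phi6_def)
next
  case (Suc k)
  let ?c = "cell_state phi6 N x"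
  have cancel_middle: "((a + b) + (b + c)) mod 2 = (a + c) mod 2" for a b c :: nat
    by presburger
  \<comment> \<open>Both halves contribute the middle cell \<open>i\<close>, which cancels.\<close>
  have "?c (t + 2 ^ Suc k) i = ?c ((t + 2 ^ k) + 2 ^ k) i"
    by (simp add: mult_2 add.assoc)
  also have "\<dots> = (?c (t + 2 ^ k) (i - 2 ^ k) + ?c (t + 2 ^ k) (i + 2 ^ k)) mod 2"
    by (rule Suc.IH)
  also have "\<dots> = ((?c t (i - 2 ^ k - 2 ^ k) + ?c t i) + (?c t i + ?c t (i + 2 ^ k + 2 ^ k))) mod 2"
    by (simp add: Suc.IH mod_add_eq)
  also have "\<dots> = (?c t (i - 2 ^ k - 2 ^ k) + ?c t (i + 2 ^ k + 2 ^ k)) mod 2"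
    by (rule cancel_middle)
  also have "i - 2 ^ k - 2 ^ k = i - 2 ^ Suc k"
    by simp
  also have "i + 2 ^ k + 2 ^ k = i + 2 ^ Suc k"
    by simp
  finally show ?case .
qed

lemma cell_state_cong_mod:
  assumes "i mod int N = j mod int N"
  shows "cell_state phi N x t i = cell_state phi N x t j"
  using assms
proof (induction t arbitrary: i j)
  case (Suc t)
  have "cell_state phi N x t (i - 1) = cell_state phi N x t (j - 1)"
    by (rule Suc.IH) (metis Suc.prems mod_diff_left_eq)
  moreover have "cell_state phi N x t (i + 1) = cell_state phi N x t (j + 1)"
    by (rule Suc.IH) (metis Suc.prems mod_add_left_eq)
  ultimately show ?case by simp
qed simp

section \<open>Circles of length a power of two\<close>

lemma stabilizes_phi6_power2: "stabilizes phi6 (2 ^ k) x i"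
  unfolding stabilizes_def
proof (intro exI allI impI)
  fix t :: nat
  have zero: "cell_state phi6 (2 ^ k) x (s + 2 ^ k) i = 0" for s
  proof -
    have "cell_state phi6 (2 ^ k) x s (i - 2 ^ k) = cell_state phi6 (2 ^ k) x s (i + 2 ^ k)"
      by (rule cell_state_cong_mod) simp
    then show ?thesis by (simp add: cell_state_phi6_add_power2)
  qed
  assume "2 ^ k \<le> t"
  then show "cell_state phi6 (2 ^ k) x t i = cell_state phi6 (2 ^ k) x (2 ^ k) i"
    using zero[of "t - 2 ^ k"] zero[of 0] by simp
qed

corollary stab_prob_power2: "stab_prob (2 ^ k) = 1"
  by (simp add: stab_prob_def stabilizes_phi6_power2)

section \<open>Circles of length one less than a power of two\<close>

lemma cell_state_phi6_periodic:
  assumes N: "N = 2 ^ k - 1" and "t \<ge> 1"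
  shows "cell_state phi6 N x (t + n * N) i = cell_state phi6 N x t i"
proof (induction n)
  case (Suc n)
  let ?c = "cell_state phi6 N x"
  define s where "s = t + n * N - 1"
  have int_N: "int N = 2 ^ k - 1"
    by (simp add: N)
  have wrap: "(i + 2 ^ k) mod int N = (i + 1) mod int N" "(i - 2 ^ k) mod int N = (i - 1) mod int N"
    using mod_add_self2[of "i + 1" "int N"] minus_mod_self2[of "i - 1" "int N"]
    unfolding int_N by (simp_all add: algebra_simps)
  have "N + 1 = 2 ^ k"
    by (simp add: N)
  then have "t + Suc n * N = s + 2 ^ k"
    using \<open>t \<ge> 1\<close> by (simp add: s_def flip: \<open>N + 1 = 2 ^ k\<close>)
  then have "?c (t + Suc n * N) i = (?c s (i - 2 ^ k) + ?c s (i + 2 ^ k)) mod 2"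
    by (simp only: cell_state_phi6_add_power2)
  also have "\<dots> = ?c (Suc s) i"
    using wrap[THEN cell_state_cong_mod, of phi6 x s] by (simp add: phi6_def)
  also have "Suc s = t + n * N"
    using \<open>t \<ge> 1\<close> by (simp add: s_def)
  finally show ?case using Suc.IH by simp
qed simp

lemma stabilizes_phi6_imp_constant:
  assumes "N = 2 ^ k - 1" "N > 0" "stabilizes phi6 N x i" "s \<ge> 1" "t \<ge> 1"
  shows "cell_state phi6 N x s i = cell_state phi6 N x t i"
proof -
  obtain T where T: "\<And>t. t \<ge> T \<Longrightarrow> cell_state phi6 N x t i = cell_state phi6 N x T i"
    using assms(3) unfolding stabilizes_def by blast
  have "r + T * N \<ge> T" for r
    using \<open>N > 0\<close> by (cases N) auto
  then have "cell_state phi6 N x r i = cell_state phi6 N x T i" if "r \<ge> 1" for r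
    using T[of "r + T * N"] cell_state_phi6_periodic[OF assms(1) that, of x T i] by simp
  then show ?thesis using assms by simp
qed

definition flip :: "int \<Rightarrow> (int \<Rightarrow> nat) \<Rightarrow> int \<Rightarrow> nat" where
  "flip j x = x(j := 1 - x j)"

text \<open>
  For \<open>j < m\<close> the cells \<open>2 ^ j\<close> and \<open>N - 2 ^ j\<close>, whose sum is the value of cell \<open>0\<close> at
  time \<open>2 ^ j\<close>, lie in the first and second half of the circle, respectively. As cell \<open>2 ^ l\<close> lies in
  the first half, it is one of them only when \<open>j = l\<close>.
\<close>

lemma cell_state_phi6_flip:
  assumes N: "N = 2 ^ Suc m - 1" and "j < m" "l < m" and x: "x (2 ^ l) \<in> {0, 1}"
  shows "cell_state phi6 N (flip (2 ^ l) x) (2 ^ j) 0 =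
           (if j = l then 1 - cell_state phi6 N x (2 ^ j) 0 else cell_state phi6 N x (2 ^ j) 0)"
proof -
  have int_N: "int N = 2 * 2 ^ m - 1"
    by (simp add: N)
  have le: "2 * (2::int) ^ i \<le> 2 ^ m" if "i < m" for i
    using power_increasing[of "Suc i" m "2::int"] that by simp
  have pos: "(2::int) ^ i > 0" for i
    by simp
  have right: "(2::int) ^ j mod int N = 2 ^ j"
    unfolding int_N using le[OF \<open>j < m\<close>] pos[of j] pos[of m]
    by (intro mod_pos_pos_trivial) linarith+
  have "(- ((2::int) ^ j)) mod int N = (int N - 2 ^ j) mod int N"
    by (metis add_uminus_conv_diff mod_add_self1)
  also have "\<dots> = int N - 2 ^ j"
    unfolding int_N using le[OF \<open>j < m\<close>] pos[of j] pos[of m]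
    by (intro mod_pos_pos_trivial) linarith+
  finally have left: "(- ((2::int) ^ j)) mod int N = int N - 2 ^ j" .
  have sum_of_pair: "cell_state phi6 N y (2 ^ j) 0 = (y (int N - 2 ^ j) + y (2 ^ j)) mod 2" for y
    using cell_state_phi6_add_power2[of N y 0 j 0] by (simp add: left right)
  have "int N - 2 ^ j \<noteq> 2 ^ l"
    unfolding int_N using le[OF \<open>j < m\<close>] le[OF \<open>l < m\<close>] pos[of j] by linarith
  moreover have "(2::int) ^ j = 2 ^ l \<longleftrightarrow> j = l"
    by simp
  ultimately have cells: "flip (2 ^ l) x (int N - 2 ^ j) = x (int N - 2 ^ j)"
    "flip (2 ^ l) x (2 ^ j) = (if j = l then 1 - x (2 ^ j) else x (2 ^ j))"
    by (simp_all add: flip_def)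
  have "(a + (1 - b)) mod 2 = 1 - (a + b) mod 2" if "b \<in> {0, 1}" for a b :: nat
    using that by (auto simp: mod_Suc)
  then show ?thesis
    unfolding sum_of_pair cells using x by simp
qed

abbreviation configurations :: "nat \<Rightarrow> (int \<Rightarrow> nat) set" where
  "configurations N \<equiv> PiE_dflt {0..<int N} 0 (\<lambda>_. {0, 1})"

lemma initial_pmf_uniform: "initial_pmf N = pmf_of_set (configurations N)"
proof -
  have "map_pmf of_bool (bernoulli_pmf (1/2)) = map_pmf of_bool (pmf_of_set (UNIV :: bool set))"
    by (simp add: bernoulli_pmf_half_conv_pmf_of_set)
  also have "\<dots> = pmf_of_set (of_bool ` UNIV :: nat set)"
    by (rule map_pmf_of_set_inj) (auto simp: inj_on_def)
  also have "(of_bool ` UNIV :: nat set) = {0, 1}"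
    by (auto simp: UNIV_bool)
  finally show ?thesis
    by (simp add: initial_pmf_def Pi_pmf_of_set)
qed

text \<open>
  With at least three observation times, a sequence that differs from a constant one in exactly one
  place determines that place; this makes the flipped copies of the stabilizing set disjoint.
\<close>

lemma stab_prob_power2_minus_1_le:
  assumes "m \<ge> 3"
  shows "stab_prob (2 ^ Suc m - 1) \<le> 1 / real m"
proof -
  define N :: nat where "N = 2 ^ Suc m - 1"
  define E where "E = configurations N \<inter> {x. stabilizes phi6 N x 0}"
  let ?v = "\<lambda>x j. cell_state phi6 N x (2 ^ j) 0"
  have int_N: "int N = 2 * 2 ^ m - 1"
    by (simp add: N_def)
  have fin: "finite (configurations N)"
    by (intro finite_PiE_dflt) auto
  have nonempty: "configurations N \<noteq> {}"
    by (auto simp: PiE_dflt_def intro!: exI[of _ "\<lambda>_. 0"])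
  have site: "(2::int) ^ l \<in> {0..<int N}" if "l < m" for l
    proof -
    have "(2::int) ^ l < 2 ^ m" "(2::int) ^ l > 0"
      using power_strict_increasing[OF that, of "2::int"] by simp_all
    then have "(2::int) ^ l < 2 * 2 ^ m - 1"
      by linarith
    then show ?thesis by (simp add: int_N)
  qed
  have binary: "x (2 ^ l) \<in> {0, 1}" if "x \<in> configurations N" "l < m" for x l
    using that site[of l] unfolding PiE_dflt_def by blast
  have agree: "?v x i = ?v x j" if "x \<in> E" for x i j
  proof (rule stabilizes_phi6_imp_constant[OF N_def])
    show "N > 0"
      using assms site[of 0] by simp
  qed (use that in \<open>auto simp: E_def\<close>)
  have flip_v: "?v (flip (2 ^ l) x) j = (if j = l then 1 - ?v x j else ?v x j)"
    if "x \<in> E" "j < m" "l < m" for x j l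
    using that binary by (intro cell_state_phi6_flip[OF N_def]) (auto simp: E_def)
  have disjoint: "flip (2 ^ l) ` E \<inter> flip (2 ^ l') ` E = {}"
    if "l < m" "l' < m" "l \<noteq> l'" for l l'
  proof (rule ccontr)
    assume "flip (2 ^ l) ` E \<inter> flip (2 ^ l') ` E \<noteq> {}"
    then obtain x x' where x: "x \<in> E" "x' \<in> E" "flip (2 ^ l) x = flip (2 ^ l') x'"
      by auto
    have "\<exists>p\<in>{0, 1, 2}. p \<noteq> l \<and> p \<noteq> l'"
      by auto
    then obtain p where p: "p \<in> {0, 1, 2}" "p \<noteq> l" "p \<noteq> l'"
      by blast
    have "p < m"
      using p(1) assms by auto
    have "1 - ?v x l = ?v x' l"
      using flip_v[of x l l] flip_v[of x' l l'] x that by simp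
    moreover have "?v x p = ?v x' p"
      using flip_v[of x p l] flip_v[of x' p l'] x that p \<open>p < m\<close> by simp
    ultimately show False
      using agree[OF x(1), of l p] agree[OF x(2), of l p] by simp presburger
  qed
  have inj: "inj_on (flip (2 ^ l)) E" if "l < m" for l
  proof (rule inj_on_inverseI)
    fix x assume "x \<in> E"
    then have "x (2 ^ l) \<in> {0, 1}" using binary that by (simp add: E_def)
    then show "flip (2 ^ l) (flip (2 ^ l) x) = x" by (auto simp: flip_def)
  qed
  have "m * card E = (\<Sum>l<m. card (flip (2 ^ l) ` E))"
    using inj by (simp add: card_image)
  also have "\<dots> = card (\<Union>l<m. flip (2 ^ l) ` E)"
    using disjoint fin by (intro card_UN_disjoint[symmetric]) (auto simp: E_def)
  also have "\<dots> \<le> card (configurations N)"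
  proof (rule card_mono[OF fin], rule UN_least)
    fix l assume "l \<in> {..<m}"
    then have l: "2 ^ l \<in> {0..<int N}"
      using site by simp
    have complement: "1 - b \<in> {0, 1}" for b :: nat
      by (cases b) auto
    show "flip (2 ^ l) ` E \<subseteq> configurations N"
    proof (rule image_subsetI)
      fix x assume "x \<in> E"
      then have x: "y \<in> {0..<int N} \<longrightarrow> x y \<in> {0, 1}" "y \<notin> {0..<int N} \<longrightarrow> x y = 0" for y
        unfolding E_def PiE_dflt_def by blast+
      have "(y \<in> {0..<int N} \<longrightarrow> flip (2 ^ l) x y \<in> {0, 1}) \<and>
            (y \<notin> {0..<int N} \<longrightarrow> flip (2 ^ l) x y = 0)" for y
        using l x[of y] complement[of "x y"] unfolding flip_def
        by (cases "y = 2 ^ l") (simp_all only: fun_upd_same fun_upd_other not_False_eq_True simp_thms)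
      then show "flip (2 ^ l) x \<in> configurations N"
        unfolding PiE_dflt_def by blast
    qed
  qed
  finally have "real m * real (card E) \<le> real (card (configurations N))"
    by (metis of_nat_le_iff of_nat_mult)
  moreover have "card (configurations N) > 0"
    using fin nonempty by (simp add: card_gt_0_iff)
  ultimately have "real (card E) / real (card (configurations N)) \<le> 1 / real m"
    using assms by (simp add: field_simps)
  moreover have "stab_prob N = real (card E) / real (card (configurations N))"
    unfolding stab_prob_def initial_pmf_uniform E_def
    by (rule measure_pmf_of_set[OF nonempty fin])
  ultimately show ?thesis
    by (simp only: N_def[symmetric])
qed

section \<open>Lower and upper limit\<close>

theorem proposition1:
  "liminf (\<lambda>N. ereal (stab_prob N)) = 0 \<and> limsup (\<lambda>N. ereal (stab_prob N)) = 1"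
proof
  let ?X = "\<lambda>N. ereal (stab_prob N)"
  have bounds: "0 \<le> ?X N" "?X N \<le> 1" for N
    by (simp_all add: stab_prob_def)
  define r :: "nat \<Rightarrow> nat" where "r m = 2 ^ Suc m - 1" for m
  have "strict_mono r"
    unfolding strict_mono_Suc_iff r_def by (simp add: diff_less_mono)
  have "(\<lambda>m. stab_prob (r m)) \<longlonglongrightarrow> 0"
  proof (rule tendsto_sandwich)
    show "\<forall>\<^sub>F m in sequentially. 0 \<le> stab_prob (r m)"
      by (simp add: stab_prob_def)
    show "\<forall>\<^sub>F m in sequentially. stab_prob (r m) \<le> 1 / real m"
      unfolding r_def using stab_prob_power2_minus_1_le eventually_sequentially by blast
    show "(\<lambda>m. 1 / real m) \<longlonglongrightarrow> 0"
      by (rule lim_1_over_n)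
  qed simp
  then have "(?X \<circ> r) \<longlonglongrightarrow> 0"
    by (simp add: o_def zero_ereal_def)
  then have "liminf (?X \<circ> r) = 0"
    by (rule lim_imp_Liminf[OF sequentially_bot])
  then have "liminf ?X \<le> 0"
    using liminf_subseq_mono[OF \<open>strict_mono r\<close>, of ?X] by simp
  moreover have "0 \<le> liminf ?X"
    using bounds by (intro Liminf_bounded) auto
  ultimately show "liminf ?X = 0"
    by (rule antisym)
  have "strict_mono (\<lambda>k. 2 ^ k :: nat)"
    by (simp add: strict_mono_Suc_iff)
  then have "limsup (?X \<circ> (\<lambda>k. 2 ^ k)) \<le> limsup ?X"
    by (rule limsup_subseq_mono)
  moreover have "?X \<circ> (\<lambda>k. 2 ^ k) = (\<lambda>_. 1)"
    by (simp add: o_def stab_prob_power2 one_ereal_def)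
  moreover have "limsup (\<lambda>_::nat. 1 :: ereal) = 1"
    by (rule Limsup_const[OF sequentially_bot])
  moreover have "limsup ?X \<le> 1"
    using bounds by (intro Limsup_bounded) auto
  ultimately show "limsup ?X = 1"
    by (intro antisym) simp_all
qed

end
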